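(* Let $X$ be a real Hilbert space, let $A\colon X\rightrightarrows X$ and $B\colon X\rightrightarrows X$ be maximally monotone, and let $T=\operatorname{Id}-J_A+J_BR_A$ be the Douglas–Rachford operator associated with $(A,B)$. Then the following implications hold: (i) If $A$ and $B$ are $3^*$ monotone, then $\overline{\operatorname{ran}}\,T=\overline{(\operatorname{dom}A-\operatorname{ran}B)\cap(\operatorname{ran}A+\operatorname{dom}B)}$. (ii) If there exists $C\in\{A,B^{-1}\}$ such that $\operatorname{dom}C=X$ and $C$ is $3^*$ monotone, then $\overline{\operatorname{ran}}\,T=\overline{\operatorname{ran}A+\operatorname{dom}B}$. (iii) If there exists $C\in\{A,B^{-1}\}$ such that $\operatorname{ran}C=X$ and $C$ is $3^*$ monotone, then $\overline{\operatorname{ran}}\,T=\overline{\operatorname{dom}A-\operatorname{ran}B}$.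
   Context: $X$ is a real Hilbert space (possibly infinite-dimensional) with inner product $\langle\cdot,\cdot\rangle$ and norm $\|\cdot\|$. For a set-valued operator $C\colon X\rightrightarrows X$: $\operatorname{gra}C=\{(x,u)\in X\times X : u\in Cx\}$, $\operatorname{dom}C=\{x : Cx\neq\varnothing\}$, $\operatorname{ran}C=\bigcup_{x\in X}Cx$, and $C^{-1}$ is the operator with graph $\{(u,x) : (x,u)\in\operatorname{gra}C\}$. $C$ is monotone if $\langle x-y,u-v\rangle\ge 0$ for all $(x,u),(y,v)\in\operatorname{gra}C$, and maximally monotone if moreover no proper extension of $\operatorname{gra}C$ is the graph of a monotone operator. The resolvent is $J_C=(\operatorname{Id}+C)^{-1}$ (single-valued and defined on all of $X$ when $C$ is maximally monotone) and the reflected resolvent is $R_C=2J_C-\operatorname{Id}$. A monotone operator $C$ is $3^*$ monotone if for every $(y,z^* )\in\operatorname{dom}C\times\operatorname{ran}C$ one has $\inf_{(x,x^* )\in\operatorname{gra}C}\langle x-y,x^*-z^*\rangle>-\infty$. Sums and differences of sets are Minkowski sums and differences; overlines denote norm closures, and $\overline{\operatorname{ran}}$ is the closure of the range. *)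

theory Defs
  imports "HOL-Analysis.Analysis" "HOL-Library.Set_Algebras"
begin

text \<open>
  Set-valued operators on a real Hilbert space \<open>X\<close> are functions \<open>'a \<Rightarrow> 'a set\<close>, where
  \<open>'a\<close> is of sort \<open>{real_inner, complete_space}\<close> (the completeness is only needed in the theorem).
\<close>

definition gra :: "('a \<Rightarrow> 'b set) \<Rightarrow> ('a \<times> 'b) set" where
  "gra C = {(x, u). u \<in> C x}"

definition op_dom :: "('a \<Rightarrow> 'b set) \<Rightarrow> 'a set" where
  "op_dom C = {x. C x \<noteq> {}}"

definition op_ran :: "('a \<Rightarrow> 'b set) \<Rightarrow> 'b set" where
  "op_ran C = (\<Union>x. C x)"

definition op_inverse :: "('a \<Rightarrow> 'b set) \<Rightarrow> ('b \<Rightarrow> 'a set)" where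
  "op_inverse C = (\<lambda>u. {x. (x, u) \<in> gra C})"

definition monotone_op :: "('a::real_inner \<Rightarrow> 'a set) \<Rightarrow> bool" where
  "monotone_op C \<longleftrightarrow>
     (\<forall>(x, u) \<in> gra C. \<forall>(y, v) \<in> gra C. inner (x - y) (u - v) \<ge> 0)"

definition maximally_monotone :: "('a::real_inner \<Rightarrow> 'a set) \<Rightarrow> bool" where
  "maximally_monotone C \<longleftrightarrow>
     monotone_op C \<and> \<not> (\<exists>D. monotone_op D \<and> gra C \<subset> gra D)"

text \<open>The infimum is taken in the extended reals, so that it may be \<open>-\<infinity>\<close>.\<close>

definition three_star_monotone :: "('a::real_inner \<Rightarrow> 'a set) \<Rightarrow> bool" where
  "three_star_monotone C \<longleftrightarrow> monotone_op C \<and>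
     (\<forall>(y, z') \<in> op_dom C \<times> op_ran C.
        (INF (x, x') \<in> gra C. ereal (inner (x - y) (x' - z'))) > -\<infinity>)"

text \<open>
  The resolvent \<open>(Id + C)\<^sup>-\<^sup>1\<close> as a point-valued map: for maximally monotone \<open>C\<close> the set below is
  a singleton for every \<open>x\<close> (Minty); otherwise the description may be unspecified.  The sum
  \<open>{y} + C y\<close> is the Minkowski sum.
\<close>

definition resolvent :: "('a::real_inner \<Rightarrow> 'a set) \<Rightarrow> 'a \<Rightarrow> 'a" where
  "resolvent C x = (THE y. y \<in> op_inverse (\<lambda>y. {y} + C y) x)"

definition reflected_resolvent :: "('a::real_inner \<Rightarrow> 'a set) \<Rightarrow> 'a \<Rightarrow> 'a" where
  "reflected_resolvent C x = 2 *\<^sub>R resolvent C x - x"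

definition douglas_rachford ::
    "('a::real_inner \<Rightarrow> 'a set) \<Rightarrow> ('a \<Rightarrow> 'a set) \<Rightarrow> 'a \<Rightarrow> 'a" where
  "douglas_rachford A B x = x - resolvent A x + resolvent B (reflected_resolvent A x)"

text \<open>
  Minkowski difference; the operation \<open>-\<close> on sets is the set-theoretic difference, whereas \<open>+\<close>
  on sets (from \<open>Set_Algebras\<close>) is the Minkowski sum.
\<close>

definition minkowski_diff :: "'a::minus set \<Rightarrow> 'a set \<Rightarrow> 'a set" where
  "minkowski_diff S T = {s - t | s t. s \<in> S \<and> t \<in> T}"

end

theory Submission
  imports Defs
begin

text \<open>
  Writing \<open>x = a + a*\<close> with \<open>(a, a*) \<in> gra A\<close> and \<open>R\<^sub>A x = b + b*\<close> with \<open>(b, b*) \<in> gra B\<close> gives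
  \<open>T x = a* + b = a - b*\<close>, so \<open>ran T\<close> lies in both Minkowski sets.  Conversely, suppose
  \<open>w = p* + q = r - s*\<close> with \<open>(r, p*) \<in> dom A \<times> ran A\<close> and \<open>(q, s*) \<in> dom B \<times> ran B\<close>, and that
  \<open>\<langle>a - r, a* - p*\<rangle>\<close> and \<open>\<langle>b - q, b* - s*\<rangle>\<close> are bounded below on the graphs.  Since \<open>2 T - Id = R\<^sub>B R\<^sub>A\<close> is
  nonexpansive, \<open>T x + \<epsilon> x = w\<close> is solvable for every \<open>\<epsilon> > 0\<close>; adding the two lower bounds yields
  \<open>\<epsilon> \<parallel>x\<parallel>\<^sup>2 \<le> O(\<epsilon> \<parallel>x\<parallel>) + O(1)\<close>, hence \<open>\<epsilon> x \<rightarrow> 0\<close> and \<open>w\<close> is a limit of points of \<open>ran T\<close>.  In (ii) and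
  (iii) the operator without a hypothesis is evaluated at a point of its graph, where monotonicity
  supplies the bound.
\<close>

section \<open>Minty's theorem\<close>

text \<open>
  The set \<open>E\<close> plays the role of the epigraph of a convex function \<open>f\<close>; the conclusion says that
  \<open>-z\<close> is a subgradient at the minimizer \<open>z\<close> of \<open>f + \<parallel>\<cdot>\<parallel>\<^sup>2 / 2\<close>.
\<close>

lemma epigraph_subgradient_exists:
  fixes E :: "('b::{real_inner, complete_space} \<times> real) set"
  assumes "closed E" "convex E" "E \<noteq> {}"
    and bdd: "\<And>z t. (z, t) \<in> E \<Longrightarrow> c \<le> t + (norm z)\<^sup>2 / 2"
  obtains z t where "(z, t) \<in> E" "\<And>z' t'. (z', t') \<in> E \<Longrightarrow> t - inner z (z' - z) \<le> t'"
proof -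
  define g where "g = (\<lambda>p :: 'b \<times> real. snd p + (norm (fst p))\<^sup>2 / 2)"
  define m where "m = Inf (g ` E)"
  have bb: "bdd_below (g ` E)"
    using bdd by (intro bdd_belowI[of _ c]) (auto simp: g_def)
  have m_le: "m \<le> g p" if "p \<in> E" for p
    unfolding m_def using bb that by (intro cInf_lower) auto
  have "\<exists>p\<in>E. g p < m + 1 / real (Suc n)" for n
    using cInf_lessD[of "g ` E" "m + 1 / real (Suc n)"] \<open>E \<noteq> {}\<close> by (auto simp: m_def)
  then obtain p where pE: "\<And>n. p n \<in> E" and pg: "\<And>n. g (p n) < m + 1 / real (Suc n)"
    by metis
  define z where "z = (\<lambda>n. fst (p n))"
  \<comment> \<open>The midpoint of two near-minimizers lies in \<open>E\<close>, so
    \<open>g\<close> is at least \<open>m\<close> there. The quadratic term puts this value below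
    the average by an eighth of the squared distance, which forces the \<open>z n\<close>
    together.\<close>
  have mid: "(norm (z n - z k))\<^sup>2 \<le> 4 * (1 / real (Suc n) + 1 / real (Suc k))" for n k
  proof -
    have "(1/2) *\<^sub>R p n + (1/2) *\<^sub>R p k \<in> E"
      using \<open>convex E\<close> pE by (intro convexD) auto
    then have "m \<le> g ((1/2) *\<^sub>R p n + (1/2) *\<^sub>R p k)" by (rule m_le)
    also have "\<dots> = (g (p n) + g (p k)) / 2 - (norm (z n - z k))\<^sup>2 / 8"
      by (simp add: g_def z_def power2_norm_eq_inner inner_simps inner_commute field_simps)
    finally have *: "m \<le> (g (p n) + g (p k)) / 2 - (norm (z n - z k))\<^sup>2 / 8" .
    have "X \<le> 4 * (u + v)"
      if "m \<le> (a + b) / 2 - X / 8" "a < m + u" "b < m + v" for X a b u v :: real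
      using that by (simp add: field_simps)
    from this[OF * pg pg] show ?thesis .
  qed
  have "Cauchy z"
  proof (rule metric_CauchyI)
    fix e :: real assume "e > 0"
    then obtain N where N: "1 / real (Suc N) < e\<^sup>2 / 8"
      using nat_approx_posE[of "e\<^sup>2 / 8"] by auto
    have "dist (z n) (z k) < e" if "n \<ge> N" "k \<ge> N" for n k
    proof -
      have "1 / real (Suc n) \<le> 1 / real (Suc N)" "1 / real (Suc k) \<le> 1 / real (Suc N)"
        using that by (simp_all add: frac_le)
      moreover have "X < Y"
        if "X \<le> 4 * (u + v)" "u \<le> w" "v \<le> w" "w < Y / 8" for X Y u v w :: real
        using that by simp
      ultimately have "(norm (z n - z k))\<^sup>2 < e\<^sup>2" using mid N by blast
      then show ?thesis using \<open>e > 0\<close> by (simp add: dist_norm power2_less_imp_less)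
    qed
    then show "\<exists>M. \<forall>m\<ge>M. \<forall>n\<ge>M. dist (z m) (z n) < e" by blast
  qed
  then obtain z0 where z0: "z \<longlonglongrightarrow> z0" using Cauchy_convergent convergent_def by blast
  have glim: "(\<lambda>n. g (p n)) \<longlonglongrightarrow> m"
  proof (rule tendsto_sandwich[of "\<lambda>n. m"])
    show "(\<lambda>n. m + 1 / real (Suc n)) \<longlonglongrightarrow> m"
      using tendsto_add[OF tendsto_const LIMSEQ_inverse_real_of_nat, of m]
      by (simp add: inverse_eq_divide)
  qed (use m_le pE pg in \<open>auto intro!: always_eventually less_imp_le\<close>)
  \<comment> \<open>The second components converge because \<open>g (p n)\<close> tends to
    \<open>m\<close>; hence \<open>g\<close> attains its minimum at \<open>(z0, t0)\<close>.\<close>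
  define t0 where "t0 = m - (norm z0)\<^sup>2 / 2"
  have "(\<lambda>n. (z n, g (p n) - (norm (z n))\<^sup>2 / 2)) \<longlonglongrightarrow> (z0, t0)"
    unfolding t0_def by (intro tendsto_intros glim z0) auto
  moreover have "(z n, g (p n) - (norm (z n))\<^sup>2 / 2) = p n" for n
    by (simp add: g_def z_def)
  ultimately have "p \<longlonglongrightarrow> (z0, t0)" by simp
  with \<open>closed E\<close> pE have E0: "(z0, t0) \<in> E" by (rule closed_sequentially)
  have "t0 - inner z0 (z' - z0) \<le> t'" if E': "(z', t') \<in> E" for z' t'
  proof (rule ccontr)
    assume neg: "\<not> ?thesis"
    define d where "d = t0 - inner z0 (z' - z0) - t'"
    define q where "q = (norm (z' - z0))\<^sup>2"
    have "d > 0" "q \<ge> 0" using neg by (auto simp: d_def q_def)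
    \<comment> \<open>Moving from the minimizer towards \<open>(z', t')\<close> by a fraction
      \<open>l\<close> gains \<open>l * d\<close> at a cost quadratic in \<open>l\<close>.\<close>
    have lam: "d \<le> l * q / 2" if "0 < l" "l \<le> 1" for l
    proof -
      have "(1 - l) *\<^sub>R (z0, t0) + l *\<^sub>R (z', t') \<in> E"
        using \<open>convex E\<close> E0 E' that by (intro convexD) auto
      then have "m \<le> g ((1 - l) *\<^sub>R (z0, t0) + l *\<^sub>R (z', t'))" by (rule m_le)
      also have "\<dots> = m + l * (l * q / 2 - d)"
        by (simp add: g_def d_def q_def t0_def power2_norm_eq_inner inner_simps inner_commute)
           (simp add: field_simps)
      finally have "0 \<le> l * (l * q / 2 - d)" by simp
      then show ?thesis using mult_le_cancel_left_pos[OF \<open>0 < l\<close>, of 0] by simp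
    qed
    \<comment> \<open>This choice makes \<open>l * q + l\<close> at most \<open>d\<close>, against
      the bound \<open>l * q / 2\<close> for \<open>d\<close>.\<close>
    define l where "l = min 1 (d / (q + 1))"
    have "0 < l" "l \<le> 1" "l * (q + 1) \<le> d"
      using \<open>d > 0\<close> \<open>q \<ge> 0\<close> by (auto simp: l_def simp flip: pos_le_divide_eq)
    moreover have "0 \<le> l * q" using \<open>0 < l\<close> \<open>q \<ge> 0\<close> by simp
    ultimately show False using lam[of l] by (simp add: distrib_left)
  qed
  with E0 show thesis by (rule that)
qed

text \<open>
  The set \<open>E\<close> in the proof is the epigraph of the Fitzpatrick function of \<open>G\<close>, which dominates the
  duality pairing because \<open>G\<close> is maximal.
\<close>

lemma maximal_monotone_set_antidiagonal:
  fixes G :: "('a::{real_inner, complete_space} \<times> 'a) set"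
  assumes mono: "\<And>x u y v. (x, u) \<in> G \<Longrightarrow> (y, v) \<in> G \<Longrightarrow> 0 \<le> inner (x - y) (u - v)"
    and maxi: "\<And>x u. (\<And>y v. (y, v) \<in> G \<Longrightarrow> 0 \<le> inner (x - y) (u - v)) \<Longrightarrow> (x, u) \<in> G"
  shows "\<exists>x. (x, - x) \<in> G"
proof -
  define E :: "(('a \<times> 'a) \<times> real) set" where
    "E = (\<Inter>(a, b)\<in>G. {p. inner (fst (fst p)) b + inner a (snd (fst p)) - inner a b \<le> snd p})"
  have mem_E: "((x, u), t) \<in> E \<longleftrightarrow> (\<forall>(a, b)\<in>G. inner x b + inner a u - inner a b \<le> t)" for x u t
    by (auto simp: E_def)
  have "closed E"
    unfolding E_def by (auto intro!: closed_INT closed_Collect_le continuous_intros)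
  moreover have "convex E"
    unfolding E_def
  proof (intro convex_INT, clarify)
    fix a b :: 'a
    \<comment> \<open>Each constraint defining \<open>E\<close> is a half-space with normal
      \<open>((b, a), -1)\<close>.\<close>
    have "convex {p. inner (((b, a), -1) :: ('a \<times> 'a) \<times> real) p \<le> inner a b}"
      by (rule convex_halfspace_le)
    then show "convex {p :: ('a \<times> 'a) \<times> real.
        inner (fst (fst p)) b + inner a (snd (fst p)) - inner a b \<le> snd p}"
      by (simp add: inner_prod_def inner_commute algebra_simps)
  qed
  moreover have graph_E: "((a, b), inner a b) \<in> E" if "(a, b) \<in> G" for a b
    using mono[OF that] by (fastforce simp: mem_E inner_simps)
  moreover have "G \<noteq> {}" using maxi by blast
  moreover have ge: "inner x u \<le> t" if "((x, u), t) \<in> E" for x u t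
  proof (cases "(x, u) \<in> G")
    case True
    with that show ?thesis by (auto simp: mem_E)
  next
    case False
    then obtain a b where "(a, b) \<in> G" "inner (x - a) (u - b) < 0"
      using maxi by (meson not_le)
    with that show ?thesis by (fastforce simp: mem_E inner_simps)
  qed
  moreover have bound: "0 \<le> t + (norm z)\<^sup>2 / 2" if "(z, t) \<in> E" for z t
  proof -
    obtain x u where z: "z = (x, u)" by (cases z)
    have "0 \<le> inner (x + u) (x + u)" by simp
    then have "0 \<le> inner x u + (inner x x + inner u u) / 2"
      by (simp add: inner_simps inner_commute field_simps)
    then show ?thesis using ge[of x u t] that
      by (simp add: z power2_norm_eq_inner inner_prod_def)
  qed
  ultimately obtain z t where zE: "(z, t) \<in> E"
    and min: "\<And>z' t'. (z', t') \<in> E \<Longrightarrow> t - inner z (z' - z) \<le> t'"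
    using epigraph_subgradient_exists[of E 0] by (metis ex_in_conv surj_pair)
  obtain x u where z: "z = (x, u)" by (cases z)
  \<comment> \<open>The subgradient inequality at the epigraph point over \<open>(a, b)\<close>,
    with \<open>t\<close> at least \<open>inner x u\<close>, completes to a square. Thus
    \<open>(- u, - x)\<close> is monotonically related to \<open>G\<close>, and \<open>key\<close>
    at that very point gives \<open>x + u = 0\<close>.\<close>
  have key: "inner (x + u) (x + u) \<le> inner (- u - a) (- x - b)" if "(a, b) \<in> G" for a b
    using min[OF graph_E[OF that]] ge[of x u t] zE
    by (simp add: z inner_prod_def inner_simps inner_commute)
  have "(- u, - x) \<in> G"
    by (rule maxi, rule order_trans[OF inner_ge_zero key])
  moreover from key[OF this] have "inner (x + u) (x + u) = 0"
    using inner_ge_zero[of "x + u"] by simp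
  then have "x + u = 0" by simp
  then have "- x = u" by (rule minus_unique)
  ultimately show ?thesis by (metis minus_minus)
qed

lemma monotone_opD:
  "monotone_op C \<Longrightarrow> u \<in> C x \<Longrightarrow> v \<in> C y \<Longrightarrow> 0 \<le> inner (x - y) (u - v)"
  by (auto simp: monotone_op_def gra_def)

lemma maximally_monotone_imp_monotone: "maximally_monotone C \<Longrightarrow> monotone_op C"
  by (simp add: maximally_monotone_def)

text \<open>Otherwise adjoining \<open>(x, u)\<close> to the graph would give a proper monotone
  extension.\<close>

lemma maximally_monotone_memI:
  assumes C: "maximally_monotone C"
    and rel: "\<And>y v. v \<in> C y \<Longrightarrow> 0 \<le> inner (x - y) (u - v)"
  shows "u \<in> C x"
proof (rule ccontr)
  assume notin: "u \<notin> C x"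
  have rel': "0 \<le> inner (y - x) (v - u)" if "v \<in> C y" for y v
    using rel[OF that] by (simp add: inner_simps)
  define D where "D = C(x := insert u (C x))"
  have "monotone_op D"
    using C rel rel'
    by (auto simp: monotone_op_def maximally_monotone_def gra_def D_def split: if_splits)
  moreover have "gra C \<subset> gra D"
    using notin by (auto simp: gra_def D_def)
  ultimately show False using C by (auto simp: maximally_monotone_def)
qed

text \<open>Translating the second coordinate of the graph by \<open>- x\<close> turns the claim
  into the existence of an antidiagonal point.\<close>

theorem minty:
  fixes C :: "'a::{real_inner, complete_space} \<Rightarrow> 'a set"
  assumes C: "maximally_monotone C"
  shows "\<exists>y. x - y \<in> C y"
proof -
  have mono: "monotone_op C" using C by (rule maximally_monotone_imp_monotone)
  have "\<exists>y. (y, - y) \<in> {(a, b). b + x \<in> C a}"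
  proof (rule maximal_monotone_set_antidiagonal)
    fix a b c d assume "(a, b) \<in> {(a, b). b + x \<in> C a}" "(c, d) \<in> {(a, b). b + x \<in> C a}"
    then show "0 \<le> inner (a - c) (b - d)"
      using monotone_opD[OF mono, of "b + x" a "d + x" c] by simp
  next
    fix a b assume rel: "\<And>c d. (c, d) \<in> {(a, b). b + x \<in> C a} \<Longrightarrow> 0 \<le> inner (a - c) (b - d)"
    have "b + x \<in> C a"
    proof (rule maximally_monotone_memI[OF C])
      fix c d assume "d \<in> C c"
      then show "0 \<le> inner (a - c) (b + x - d)"
        using rel[of c "d - x"] by (simp add: algebra_simps)
    qed
    then show "(a, b) \<in> {(a, b). b + x \<in> C a}" by simp
  qed
  then show ?thesis by auto
qed

section \<open>Resolvents and the Douglas--Rachford operator\<close>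

text \<open>Minty's theorem supplies existence for the definite description; two solutions coincide
  because monotonicity makes minus their squared distance nonnegative.\<close>

lemma resolvent_mem:
  fixes C :: "'a::{real_inner, complete_space} \<Rightarrow> 'a set"
  assumes C: "maximally_monotone C"
  shows "x - resolvent C x \<in> C (resolvent C x)"
proof -
  have mono: "monotone_op C" using C by (rule maximally_monotone_imp_monotone)
  have iff: "y \<in> op_inverse (\<lambda>y. {y} + C y) x \<longleftrightarrow> x - y \<in> C y" for y
    by (auto simp: op_inverse_def gra_def set_plus_def algebra_simps)
       (metis add_diff_cancel_left' diff_add_cancel add.commute)
  have uniq: "y = y'" if "x - y \<in> C y" "x - y' \<in> C y'" for y y'
  proof -
    have "0 \<le> inner (y - y') ((x - y) - (x - y'))"
      using monotone_opD[OF mono that] .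
    also have "\<dots> = - inner (y - y') (y - y')" by (simp add: inner_simps)
    finally have "inner (y - y') (y - y') = 0" using inner_ge_zero[of "y - y'"] by linarith
    then show ?thesis by simp
  qed
  have "\<exists>!y. y \<in> op_inverse (\<lambda>y. {y} + C y) x"
    using minty[OF C, of x] uniq by (auto simp: iff)
  from theI'[OF this] show ?thesis unfolding iff resolvent_def .
qed

text \<open>The squared distance drops by exactly four times a monotonicity pairing of the graph
  points given by the resolvent.\<close>

lemma reflected_resolvent_nonexpansive:
  fixes C :: "'a::{real_inner, complete_space} \<Rightarrow> 'a set"
  assumes C: "maximally_monotone C"
  shows "norm (reflected_resolvent C x - reflected_resolvent C y) \<le> norm (x - y)"
proof -
  have mono: "monotone_op C" using C by (rule maximally_monotone_imp_monotone)
  let ?J = "resolvent C"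
  have "0 \<le> inner (?J x - ?J y) ((x - ?J x) - (y - ?J y))"
    by (rule monotone_opD[OF mono resolvent_mem[OF C] resolvent_mem[OF C]])
  moreover have "(norm (reflected_resolvent C x - reflected_resolvent C y))\<^sup>2 =
      (norm (x - y))\<^sup>2 - 4 * inner (?J x - ?J y) ((x - ?J x) - (y - ?J y))"
    by (simp add: reflected_resolvent_def power2_norm_eq_inner inner_simps inner_commute
        algebra_simps)
  ultimately have "(norm (reflected_resolvent C x - reflected_resolvent C y))\<^sup>2 \<le> (norm (x - y))\<^sup>2"
    by linarith
  then show ?thesis by (rule power2_le_imp_le) simp
qed

lemma douglas_rachford_decomposition:
  fixes A B :: "'a::{real_inner, complete_space} \<Rightarrow> 'a set"
  assumes "maximally_monotone A" "maximally_monotone B"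
  obtains a a' b b' where "a' \<in> A a" "b' \<in> B b" "x = a + a'"
    "douglas_rachford A B x = a' + b" "douglas_rachford A B x = a - b'"
proof
  let ?a = "resolvent A x" and ?b = "resolvent B (reflected_resolvent A x)"
  show "x - ?a \<in> A ?a" using resolvent_mem assms by blast
  show "reflected_resolvent A x - ?b \<in> B ?b" using resolvent_mem assms by blast
  show "douglas_rachford A B x = ?a - (reflected_resolvent A x - ?b)"
    by (simp add: douglas_rachford_def reflected_resolvent_def scaleR_2)
qed (simp_all add: douglas_rachford_def)

lemma range_douglas_rachford_subset:
  fixes A B :: "'a::{real_inner, complete_space} \<Rightarrow> 'a set"
  assumes "maximally_monotone A" "maximally_monotone B"
  shows "range (douglas_rachford A B) \<subseteq>
    minkowski_diff (op_dom A) (op_ran B) \<inter> (op_ran A + op_dom B)"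
proof clarify
  fix x
  obtain a a' b b' where *: "a' \<in> A a" "b' \<in> B b"
    "douglas_rachford A B x = a' + b" "douglas_rachford A B x = a - b'"
    by (rule douglas_rachford_decomposition[OF assms])
  have "douglas_rachford A B x \<in> minkowski_diff (op_dom A) (op_ran B)"
    unfolding *(4) minkowski_diff_def op_dom_def op_ran_def using *(1,2) by blast
  moreover have "douglas_rachford A B x \<in> op_ran A + op_dom B"
    unfolding *(3) using *(1,2) by (intro set_plus_intro) (auto simp: op_dom_def op_ran_def)
  ultimately show "douglas_rachford A B x \<in>
    minkowski_diff (op_dom A) (op_ran B) \<inter> (op_ran A + op_dom B)" by blast
qed

text \<open>With \<open>R = 2 T - Id\<close>, the equation reads
  \<open>(1 + 2 * e) *\<^sub>R x = 2 *\<^sub>R w - R x\<close>. As \<open>R\<close> is nonexpansive,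
  dividing by \<open>1 + 2 * e\<close> leaves a fixed-point problem for a contraction.\<close>

lemma douglas_rachford_perturbed_surj:
  fixes A B :: "'a::{real_inner, complete_space} \<Rightarrow> 'a set"
  assumes A: "maximally_monotone A" and B: "maximally_monotone B" and "0 < e"
  obtains x where "douglas_rachford A B x + e *\<^sub>R x = w"
proof -
  define R where "R = (\<lambda>x. reflected_resolvent B (reflected_resolvent A x))"
  define k where "k = 1 / (1 + 2 * e)"
  have k: "0 < k" "k < 1" using \<open>0 < e\<close> by (auto simp: k_def)
  define h where "h = (\<lambda>x. k *\<^sub>R (2 *\<^sub>R w - R x))"
  have "dist (h x) (h y) \<le> k * dist x y" for x y
  proof -
    have "h x - h y = k *\<^sub>R (R y - R x)" by (simp add: h_def algebra_simps)
    then have "dist (h x) (h y) = k * norm (R x - R y)"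
      using k by (simp add: dist_norm norm_minus_commute)
    moreover have "norm (R x - R y) \<le> norm (x - y)"
      unfolding R_def
      using reflected_resolvent_nonexpansive[OF A] reflected_resolvent_nonexpansive[OF B]
      by (rule order_trans[rotated])
    ultimately show ?thesis using k by (simp add: dist_norm)
  qed
  then obtain x where x: "h x = x"
    using banach_fix_type[of k h] k by auto
  have "(1 + 2 * e) *\<^sub>R x = (1 + 2 * e) *\<^sub>R h x" by (simp only: x)
  also have "\<dots> = 2 *\<^sub>R w - R x" using \<open>0 < e\<close> by (simp add: h_def k_def)
  finally have "R x + (1 + 2 * e) *\<^sub>R x = 2 *\<^sub>R w" by simp
  moreover have "R x = 2 *\<^sub>R douglas_rachford A B x - x"
    by (simp add: R_def douglas_rachford_def reflected_resolvent_def algebra_simps)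
       (simp add: scaleR_2)
  ultimately have "2 *\<^sub>R (douglas_rachford A B x + e *\<^sub>R x) = 2 *\<^sub>R w"
    by (simp add: algebra_simps)
  then have "douglas_rachford A B x + e *\<^sub>R x = w" by simp
  then show thesis by (rule that)
qed

text \<open>All three formulas reduce to this criterion: each lower bound may come from 3*
  monotonicity or, with constant 0, from monotonicity at a graph point.\<close>

lemma in_closure_range_douglas_rachford:
  fixes A B :: "'a::{real_inner, complete_space} \<Rightarrow> 'a set"
  assumes A: "maximally_monotone A" and B: "maximally_monotone B"
    and w: "w = p + q" "w = r - s"
    and KA: "\<And>a a'. a' \<in> A a \<Longrightarrow> K \<le> inner (a - r) (a' - p)"
    and KB: "\<And>b b'. b' \<in> B b \<Longrightarrow> L \<le> inner (b - q) (b' - s)"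
  shows "w \<in> closure (range (douglas_rachford A B))"
  unfolding closure_approachable
proof (intro allI impI)
  fix d :: real assume "0 < d"
  define c where "c = norm (r - q + w)"
  define M where "M = \<bar>K + L\<bar>"
  have "c \<ge> 0" "M \<ge> 0" by (simp_all add: c_def M_def)
  \<comment> \<open>Chosen so that \<open>t = d\<close> violates the inequality \<open>quad\<close>
    below in \<open>t = e * norm x\<close>; the violation persists for all larger
    \<open>t\<close>.\<close>
  define e where "e = d\<^sup>2 / (2 * (c * d + M + 1))"
  have den: "c * d + M + 1 > 0" using \<open>c \<ge> 0\<close> \<open>M \<ge> 0\<close> \<open>0 < d\<close> by (simp add: add_nonneg_pos)
  have "0 < e" using \<open>0 < d\<close> den by (simp add: e_def)
  have small: "e * (c * d + M) < d\<^sup>2"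
  proof -
    have "e * (c * d + M + 1) = d\<^sup>2 / 2"
      unfolding e_def using less_imp_neq[OF den] by (metis divide_divide_eq_left mult.commute
        nonzero_mult_div_cancel_right times_divide_eq_right)
    then show ?thesis using \<open>0 < e\<close> zero_less_power[OF \<open>0 < d\<close>, of 2]
      unfolding distrib_left by linarith
  qed
  obtain x where x: "douglas_rachford A B x + e *\<^sub>R x = w"
    by (rule douglas_rachford_perturbed_surj[OF A B \<open>0 < e\<close>])
  obtain a a' b b' where ab: "a' \<in> A a" "b' \<in> B b" "x = a + a'"
    "douglas_rachford A B x = a' + b" "douglas_rachford A B x = a - b'"
    by (rule douglas_rachford_decomposition[OF A B])
  have w1: "w = a' + b + e *\<^sub>R x" and w2: "w = a - b' + e *\<^sub>R x" using x ab(4,5) by simp_all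
  \<comment> \<open>The opposite signs here and in \<open>b'\<close> cancel the products of
    \<open>a - r\<close> and \<open>b - q\<close> in the sum of the two bounds, leaving only terms
    with a factor \<open>e\<close>.\<close>
  have a': "a' - p = - (b - q) - e *\<^sub>R x" using w1 w(1) by (simp add: algebra_simps)
  have b': "b' - s = (a - r) + e *\<^sub>R x" using w2 w(2) by (simp add: algebra_simps)
  have a_b: "a - b = (1 + e) *\<^sub>R x - w" unfolding w1 using ab(3) by (simp add: algebra_simps)
  have "K + L \<le> inner (a - r) (a' - p) + inner (b - q) (b' - s)"
    using KA[OF ab(1)] KB[OF ab(2)] by simp
  also have "\<dots> = e * inner (r - q - (a - b)) x"
    unfolding a' b' by (simp add: inner_simps inner_commute algebra_simps)
  also have "\<dots> = e * inner (r - q + w) x - e * (1 + e) * (norm x)\<^sup>2"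
    unfolding a_b by (simp add: inner_simps power2_norm_eq_inner algebra_simps)
  also have "\<dots> \<le> e * (c * norm x) - e * (norm x)\<^sup>2"
  proof -
    have "inner (r - q + w) x \<le> c * norm x" unfolding c_def by (rule norm_cauchy_schwarz)
    then have "e * inner (r - q + w) x \<le> e * (c * norm x)" using \<open>0 < e\<close> by simp
    moreover have "e * (norm x)\<^sup>2 \<le> e * (1 + e) * (norm x)\<^sup>2"
      using \<open>0 < e\<close> by (intro mult_right_mono) auto
    ultimately show ?thesis by simp
  qed
  finally have "e * (norm x)\<^sup>2 \<le> e * (c * norm x) + M" by (simp add: M_def)
  \<comment> \<open>The extra factor \<open>e\<close> yields a quadratic inequality in
    \<open>e * norm x\<close>, the distance from \<open>w\<close> to the value at
    \<open>x\<close>.\<close>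
  then have "e * (e * (norm x)\<^sup>2) \<le> e * (e * (c * norm x) + M)" using \<open>0 < e\<close> by simp
  then have quad: "(e * norm x)\<^sup>2 \<le> e * (c * (e * norm x) + M)"
    by (simp add: power2_eq_square algebra_simps)
  have "e * norm x < d"
  proof (rule ccontr)
    define t where "t = e * norm x"
    assume "\<not> ?thesis"
    then have "d \<le> t" by (simp add: t_def)
    have "t * d \<le> t\<^sup>2" using \<open>d \<le> t\<close> \<open>0 < d\<close> by (simp add: power2_eq_square)
    have "M * d \<le> M * t" using \<open>d \<le> t\<close> \<open>M \<ge> 0\<close> by (simp add: mult_left_mono)
    have "d * t\<^sup>2 \<le> d * (e * (c * t + M))" using quad \<open>0 < d\<close> by (simp add: t_def)
    also have "\<dots> \<le> (e * (c * d + M)) * t"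
    proof -
      have "e * (M * d) \<le> e * (M * t)" using \<open>M * d \<le> M * t\<close> \<open>0 < e\<close> by simp
      then show ?thesis by (simp add: algebra_simps)
    qed
    also have "\<dots> < d\<^sup>2 * t" using small \<open>0 < d\<close> \<open>d \<le> t\<close> by (intro mult_strict_right_mono) auto
    also have "\<dots> \<le> d * t\<^sup>2"
      using \<open>t * d \<le> t\<^sup>2\<close> \<open>0 < d\<close> by (simp add: power2_eq_square algebra_simps)
    finally show False by simp
  qed
  moreover have "dist (douglas_rachford A B x) w = e * norm x"
    using x \<open>0 < e\<close> by (auto simp: dist_norm simp flip: x)
  ultimately have "dist (douglas_rachford A B x) w < d" by simp
  then show "\<exists>y\<in>range (douglas_rachford A B). dist y w < d" by blast
qed

section \<open>The range formulas\<close>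

text \<open>Any real strictly between minus infinity and the extended-real infimum serves as
  \<open>K\<close>.\<close>

lemma three_star_monotone_bound:
  assumes "three_star_monotone C" "y \<in> op_dom C" "z \<in> op_ran C"
  obtains K where "\<And>x x'. x' \<in> C x \<Longrightarrow> K \<le> inner (x - y) (x' - z)"
proof -
  have "- \<infinity> < (INF (x, x') \<in> gra C. ereal (inner (x - y) (x' - z)))"
    using assms by (auto simp: three_star_monotone_def)
  then obtain K where K: "ereal K < (INF (x, x') \<in> gra C. ereal (inner (x - y) (x' - z)))"
    using ereal_dense2 by blast
  have "K \<le> inner (x - y) (x' - z)" if "x' \<in> C x" for x x'
  proof -
    have "(INF (x, x') \<in> gra C. ereal (inner (x - y) (x' - z))) \<le> ereal (inner (x - y) (x' - z))"
      using that by (intro INF_lower2[of "(x, x')"]) (auto simp: gra_def)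
    with K have "ereal K \<le> ereal (inner (x - y) (x' - z))" by order
    then show ?thesis by simp
  qed
  then show thesis by (rule that)
qed

lemma op_dom_inverse [simp]: "op_dom (op_inverse C) = op_ran C"
  by (auto simp: op_dom_def op_ran_def op_inverse_def gra_def)

lemma op_ran_inverse [simp]: "op_ran (op_inverse C) = op_dom C"
  by (auto simp: op_dom_def op_ran_def op_inverse_def gra_def)

lemma op_inverse_mem [simp]: "x \<in> op_inverse C u \<longleftrightarrow> u \<in> C x"
  by (simp add: op_inverse_def gra_def)

text \<open>Inversion swaps the two factors of a symmetric pairing, so a hypothesis on the inverse
  of \<open>B\<close> bounds the pairing on the graph of \<open>B\<close>.\<close>

lemma three_star_monotone_inverse_bound:
  assumes "three_star_monotone (op_inverse C)" "y \<in> op_dom C" "z \<in> op_ran C"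
  obtains K where "\<And>x x'. x' \<in> C x \<Longrightarrow> K \<le> inner (x - y) (x' - z)"
proof -
  obtain K where K: "\<And>x' x. x \<in> op_inverse C x' \<Longrightarrow> K \<le> inner (x' - z) (x - y)"
    using three_star_monotone_bound[OF assms(1), of z y] assms(2,3) by auto
  show thesis
    by (rule that[of K], subst inner_commute, rule K) simp
qed

lemma op_ranE: "u \<in> op_ran C \<Longrightarrow> (\<And>x. u \<in> C x \<Longrightarrow> P) \<Longrightarrow> P"
  by (auto simp: op_ran_def)

lemma op_domE: "x \<in> op_dom C \<Longrightarrow> (\<And>u. u \<in> C x \<Longrightarrow> P) \<Longrightarrow> P"
  by (auto simp: op_dom_def)

lemma minkowski_diffE:
  "w \<in> minkowski_diff S T \<Longrightarrow> (\<And>s t. w = s - t \<Longrightarrow> s \<in> S \<Longrightarrow> t \<in> T \<Longrightarrow> P) \<Longrightarrow> P"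
  by (auto simp: minkowski_diff_def)

context
  fixes A B :: "'a::{real_inner, complete_space} \<Rightarrow> 'a set"
  assumes A: "maximally_monotone A" and B: "maximally_monotone B"
begin

text \<open>Since the range lies in both Minkowski sets, each formula is left with a single
  inclusion.\<close>

lemma closure_range_douglas_rachford_eqI:
  assumes "minkowski_diff (op_dom A) (op_ran B) \<inter> (op_ran A + op_dom B) \<subseteq> S"
    and "S \<subseteq> closure (range (douglas_rachford A B))"
  shows "closure (range (douglas_rachford A B)) = closure S"
proof (rule subset_antisym)
  show "closure (range (douglas_rachford A B)) \<subseteq> closure S"
    by (rule closure_mono, rule order_trans[OF range_douglas_rachford_subset[OF A B] assms(1)])
  show "closure S \<subseteq> closure (range (douglas_rachford A B))"
    by (rule closure_minimal[OF assms(2) closed_closure])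
qed

lemma subset_closure_range_both_three_star:
  assumes "three_star_monotone A" "three_star_monotone B"
  shows "minkowski_diff (op_dom A) (op_ran B) \<inter> (op_ran A + op_dom B)
    \<subseteq> closure (range (douglas_rachford A B))"
proof
  fix w assume "w \<in> minkowski_diff (op_dom A) (op_ran B) \<inter> (op_ran A + op_dom B)"
  then obtain p q r s where w: "w = p + q" "w = r - s"
    and mem: "r \<in> op_dom A" "s \<in> op_ran B" "p \<in> op_ran A" "q \<in> op_dom B"
    by (elim IntE minkowski_diffE set_plus_elim) blast
  from three_star_monotone_bound[OF assms(1) mem(1,3)]
  obtain K where K: "\<And>a a'. a' \<in> A a \<Longrightarrow> K \<le> inner (a - r) (a' - p)" by blast
  from three_star_monotone_bound[OF assms(2) mem(4,2)]
  obtain L where L: "\<And>b b'. b' \<in> B b \<Longrightarrow> L \<le> inner (b - q) (b' - s)" by blast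
  show "w \<in> closure (range (douglas_rachford A B))"
    by (rule in_closure_range_douglas_rachford[OF A B w K L])
qed

lemma subset_closure_range_full_domain:
  assumes "C \<in> {A, op_inverse B}" "op_dom C = UNIV" "three_star_monotone C"
  shows "op_ran A + op_dom B \<subseteq> closure (range (douglas_rachford A B))"
proof
  fix w assume "w \<in> op_ran A + op_dom B"
  then obtain p p' q q' where w: "w = p' + q" and mem: "p' \<in> A p" "q' \<in> B q"
    by (auto elim!: set_plus_elim op_ranE op_domE)
  have ran: "p' \<in> op_ran A" "q \<in> op_dom B" using mem by (auto simp: op_ran_def op_dom_def)
  from assms(1) consider "C = A" | "C = op_inverse B" by blast
  then show "w \<in> closure (range (douglas_rachford A B))"
  proof cases
    case 1
    \<comment> \<open>The full domain admits \<open>r = w + q'\<close>, hence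
      \<open>w = r - q'\<close>; the bound for \<open>B\<close> is monotonicity at
      \<open>(q, q')\<close>.\<close>
    obtain K where K: "\<And>a a'. a' \<in> A a \<Longrightarrow> K \<le> inner (a - (w + q')) (a' - p')"
      using three_star_monotone_bound[of A "w + q'" p'] assms ran 1 by auto
    show ?thesis
      using in_closure_range_douglas_rachford[OF A B w _ K
        monotone_opD[OF maximally_monotone_imp_monotone[OF B] _ mem(2)]]
      by simp
  next
    case 2
    \<comment> \<open>Now \<open>B\<close> has full range, which admits \<open>s = p - w\<close>,
      and \<open>A\<close> is tested at \<open>(p, p')\<close>.\<close>
    obtain L where L: "\<And>b b'. b' \<in> B b \<Longrightarrow> L \<le> inner (b - q) (b' - (p - w))"
      using three_star_monotone_inverse_bound[of B q "p - w"] assms ran 2 by auto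
    show ?thesis
      using in_closure_range_douglas_rachford[OF A B w _
        monotone_opD[OF maximally_monotone_imp_monotone[OF A] _ mem(1)] L]
      by simp
  qed
qed

lemma subset_closure_range_full_range:
  assumes "C \<in> {A, op_inverse B}" "op_ran C = UNIV" "three_star_monotone C"
  shows "minkowski_diff (op_dom A) (op_ran B) \<subseteq> closure (range (douglas_rachford A B))"
proof
  fix w assume "w \<in> minkowski_diff (op_dom A) (op_ran B)"
  then obtain r r' s s' where w: "w = r - s'" and mem: "r' \<in> A r" "s' \<in> B s"
    by (auto elim!: minkowski_diffE op_ranE op_domE)
  have dom: "r \<in> op_dom A" "s' \<in> op_ran B" using mem by (auto simp: op_ran_def op_dom_def)
  from assms(1) consider "C = A" | "C = op_inverse B" by blast
  then show "w \<in> closure (range (douglas_rachford A B))"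
  proof cases
    case 1
    \<comment> \<open>Here the missing decomposition is the sum: full range of \<open>A\<close>
      admits \<open>w - s\<close> as the summand paired with \<open>s\<close>.\<close>
    obtain K where K: "\<And>a a'. a' \<in> A a \<Longrightarrow> K \<le> inner (a - r) (a' - (w - s))"
      using three_star_monotone_bound[of A r "w - s"] assms dom 1 by auto
    show ?thesis
      using in_closure_range_douglas_rachford[OF A B _ w K
        monotone_opD[OF maximally_monotone_imp_monotone[OF B] _ mem(2)]]
      by simp
  next
    case 2
    \<comment> \<open>Full domain of \<open>B\<close> admits \<open>w - r'\<close> as the summand
      paired with \<open>r'\<close>.\<close>
    obtain L where L: "\<And>b b'. b' \<in> B b \<Longrightarrow> L \<le> inner (b - (w - r')) (b' - s')"
      using three_star_monotone_inverse_bound[of B "w - r'" s'] assms dom 2 by auto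
    show ?thesis
      using in_closure_range_douglas_rachford[OF A B _ w
        monotone_opD[OF maximally_monotone_imp_monotone[OF A] _ mem(1)] L]
      by simp
  qed
qed

end

theorem theorem2p6:
  fixes A B :: "'a::{real_inner, complete_space} \<Rightarrow> 'a set"
    and T :: "'a \<Rightarrow> 'a"
  assumes "maximally_monotone A" and "maximally_monotone B"
    and "T = douglas_rachford A B"
  shows
    "(three_star_monotone A \<and> three_star_monotone B \<longrightarrow>
        closure (range T) =
        closure (minkowski_diff (op_dom A) (op_ran B) \<inter> (op_ran A + op_dom B))) \<and>
     ((\<exists>C \<in> {A, op_inverse B}. op_dom C = UNIV \<and> three_star_monotone C) \<longrightarrow>
        closure (range T) = closure (op_ran A + op_dom B)) \<and>
     ((\<exists>C \<in> {A, op_inverse B}. op_ran C = UNIV \<and> three_star_monotone C) \<longrightarrow>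
        closure (range T) = closure (minkowski_diff (op_dom A) (op_ran B)))"
  unfolding assms(3)
proof (intro conjI impI)
  note eqI = closure_range_douglas_rachford_eqI[OF assms(1,2)]
  show "closure (range (douglas_rachford A B)) =
      closure (minkowski_diff (op_dom A) (op_ran B) \<inter> (op_ran A + op_dom B))"
    if "three_star_monotone A \<and> three_star_monotone B"
    using that subset_closure_range_both_three_star[OF assms(1,2)] by (intro eqI) auto
  show "closure (range (douglas_rachford A B)) = closure (op_ran A + op_dom B)"
    if "\<exists>C \<in> {A, op_inverse B}. op_dom C = UNIV \<and> three_star_monotone C"
    using that subset_closure_range_full_domain[OF assms(1,2)] by (intro eqI) blast+
  show "closure (range (douglas_rachford A B)) = closure (minkowski_diff (op_dom A) (op_ran B))"
    if "\<exists>C \<in> {A, op_inverse B}. op_ran C = UNIV \<and> three_star_monotone C"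
    using that subset_closure_range_full_range[OF assms(1,2)] by (intro eqI) blast+
qed

end
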